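(* Let $\mathfrak{A}$ be a residuated lattice. The following assertions are equivalent: (1) $\mathfrak{A}$ is Gelfand; (2) $Spec_{h}(\mathfrak{A})$ is a normal space.
   Context: A residuated lattice is an algebra $\mathfrak{A}=(A;\vee,\wedge,\odot,\rightarrow,0,1)$ such that $(A;\vee,\wedge,0,1)$ is a bounded lattice, $(A;\odot,1)$ is a commutative monoid, and $x\odot y\le z$ iff $x\le y\rightarrow z$ for all $x,y,z\in A$. A filter of $\mathfrak{A}$ is a non-empty subset $F\subseteq A$ such that $x,y\in F$ implies $x\odot y\in F$, and $x\in F$, $y\in A$ imply $x\vee y\in F$. A filter is proper if it is not $A$; a maximal filter is a maximal element (under inclusion) among proper filters; a prime filter is a proper filter $\mathfrak{p}$ such that $x\vee y\in\mathfrak{p}$ implies $x\in\mathfrak{p}$ or $y\in\mathfrak{p}$. $Spec(\mathfrak{A})$ is the set of prime filters. $\mathfrak{A}$ is Gelfand if every prime filter is contained in a unique maximal filter. $Spec_h(\mathfrak{A})$ is $Spec(\mathfrak{A})$ with the hull-kernel topology, whose closed basis is $\{h(x)\mid x\in A\}$, where $h(x)=\{\mathfrak{p}\in Spec(\mathfrak{A})\mid x\in\mathfrak{p}\}$. A topological space is called normal if any two disjoint closed sets have disjoint open neighbourhoods (no separation axiom such as $T_1$ is included). *)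

theory Defs
  imports "HOL-Analysis.Analysis"
begin

text \<open>The monoid multiplication \<open>\<odot>\<close> is \<open>(*)\<close>; the axiom \<open>one_eq_top\<close> says that its unit is the
  greatest element of the lattice. The one-element algebra, where \<open>bot = top\<close>, is not excluded.\<close>

class residuated_lattice = bounded_lattice + comm_monoid_mult +
  fixes residuum :: "'a \<Rightarrow> 'a \<Rightarrow> 'a"
  assumes one_eq_top: "1 = top"
    and residuation: "x * y \<le> z \<longleftrightarrow> x \<le> residuum y z"

definition rl_filter :: "'a::residuated_lattice set \<Rightarrow> bool" where
  "rl_filter F \<longleftrightarrow> F \<noteq> {} \<and> (\<forall>x\<in>F. \<forall>y\<in>F. x * y \<in> F) \<and> (\<forall>x\<in>F. \<forall>y. sup x y \<in> F)"

definition proper_filter :: "'a::residuated_lattice set \<Rightarrow> bool" where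
  "proper_filter F \<longleftrightarrow> rl_filter F \<and> F \<noteq> UNIV"

definition maximal_filter :: "'a::residuated_lattice set \<Rightarrow> bool" where
  "maximal_filter M \<longleftrightarrow> proper_filter M \<and> (\<forall>F. proper_filter F \<longrightarrow> M \<subseteq> F \<longrightarrow> F = M)"

definition prime_filter :: "'a::residuated_lattice set \<Rightarrow> bool" where
  "prime_filter P \<longleftrightarrow> proper_filter P \<and> (\<forall>x y. sup x y \<in> P \<longrightarrow> x \<in> P \<or> y \<in> P)"

definition Spec :: "'a::residuated_lattice set set" where
  "Spec = {P. prime_filter P}"

text \<open>A property of the whole algebra, hence of the type \<open>'a\<close>.\<close>

definition gelfand :: "'a::residuated_lattice itself \<Rightarrow> bool" where
  "gelfand _ \<longleftrightarrow> (\<forall>P \<in> (Spec :: 'a set set). \<exists>!M. maximal_filter M \<and> P \<subseteq> M)"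

definition elem_hull :: "'a::residuated_lattice \<Rightarrow> 'a set set" where
  "elem_hull x = {P \<in> Spec. x \<in> P}"

text \<open>Since the sets \<open>elem_hull x\<close> form a basis of closed sets, their complements in \<open>Spec\<close> form
  a basis of open sets.\<close>

definition Spec_h :: "'a::residuated_lattice set topology" where
  "Spec_h = topology (arbitrary union_of (\<lambda>U. \<exists>x. U = Spec - elem_hull x))"

text \<open>As \<open>topology\<close> is unspecified on families that are not topologies, we check that
  the family above is one, and that \<open>Spec_h\<close> has the intended points and closed sets.\<close>

lemma elem_hull_Un: "elem_hull x \<union> elem_hull y = elem_hull (sup x y)"
proof -
  have "sup x y \<in> P" if "prime_filter P" "x \<in> P \<or> y \<in> P" for P
    using that unfolding prime_filter_def proper_filter_def rl_filter_def
    by (metis sup_commute)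
  then show ?thesis
    by (auto simp: elem_hull_def Spec_def prime_filter_def)
qed

lemma elem_hull_bot: "elem_hull bot = {}"
proof -
  have "P = UNIV" if "rl_filter P" "bot \<in> P" for P :: "'a set"
    using that unfolding rl_filter_def by (metis UNIV_eq_I sup_bot_left)
  then show ?thesis
    by (auto simp: elem_hull_def Spec_def prime_filter_def proper_filter_def)
qed

lemma istopology_Spec_h:
  "istopology (arbitrary union_of (\<lambda>U. \<exists>x::'a::residuated_lattice. U = Spec - elem_hull x))"
proof (rule istopology_base)
  fix S T :: "'a set set"
  assume "\<exists>x. S = Spec - elem_hull x" and "\<exists>x. T = Spec - elem_hull x"
  then obtain x y where "S = Spec - elem_hull x" "T = Spec - elem_hull y" by blast
  then have "S \<inter> T = Spec - elem_hull (sup x y)"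
    using elem_hull_Un[of x y] by blast
  then show "\<exists>x. S \<inter> T = Spec - elem_hull x" by blast
qed

lemma openin_Spec_h:
  "openin Spec_h U \<longleftrightarrow> (\<exists>X. U = (\<Union>x\<in>X. Spec - elem_hull x))"
proof -
  have "openin Spec_h U \<longleftrightarrow> (arbitrary union_of (\<lambda>U. \<exists>x. U = Spec - elem_hull x)) U"
    unfolding Spec_h_def by (simp only: topology_inverse'[OF istopology_Spec_h])
  also have "\<dots> \<longleftrightarrow> (\<exists>\<U> \<subseteq> range (\<lambda>x. Spec - elem_hull x). \<Union>\<U> = U)"
    by (simp add: union_of_def arbitrary_def full_SetCompr_eq)
  also have "\<dots> \<longleftrightarrow> (\<exists>X. U = (\<Union>x\<in>X. Spec - elem_hull x))"
    by (metis (no_types, lifting) subset_UNIV subset_image_iff)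
  finally show ?thesis .
qed

lemma topspace_Spec_h: "topspace Spec_h = Spec"
proof
  show "topspace Spec_h \<subseteq> Spec"
    unfolding topspace_def by (auto simp: openin_Spec_h)
  have "openin Spec_h Spec"
    unfolding openin_Spec_h by (rule exI[of _ "{bot}"]) (simp add: elem_hull_bot)
  then show "Spec \<subseteq> topspace Spec_h" by (rule openin_subset)
qed

lemma closedin_Spec_h:
  "closedin Spec_h C \<longleftrightarrow> (\<exists>X. C = Spec \<inter> (\<Inter>x\<in>X. elem_hull x))"
proof -
  have eq: "(C \<subseteq> Spec \<and> Spec - C = (\<Union>x\<in>X. Spec - elem_hull x))
      \<longleftrightarrow> C = Spec \<inter> (\<Inter>x\<in>X. elem_hull x)" for X
    by (auto simp: set_eq_iff subset_iff)
  show ?thesis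
    by (simp add: closedin_def topspace_Spec_h openin_Spec_h flip: eq)
qed

end

theory Submission
  imports Defs
begin

text \<open>
  Open sets of the spectrum are closed under passing to smaller prime filters, and a maximal filter
  is a closed point. Hence two distinct maximal filters above one prime filter \<open>P\<close> cannot be
  separated, because \<open>P\<close> lies in every neighbourhood of both; normality therefore forces
  the Gelfand property.

  For the converse, let \<open>C\<close> and \<open>D\<close> be disjoint closed sets. It is enough to find \<open>a\<close> lying in no
  member of \<open>C\<close> and \<open>b\<close> lying in no member of \<open>D\<close> with \<open>sup a b = 1\<close>: every prime filter then
  contains \<open>a\<close> or \<open>b\<close>, so the complements of the hulls of \<open>a\<close> and \<open>b\<close> separate \<open>C\<close> from \<open>D\<close>.
  The set \<open>S\<close> of all joins \<open>sup a b\<close> with \<open>a \<notin> \<Union>C\<close> and \<open>b \<notin> \<Union>D\<close> is closed under joins, because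
  the members of \<open>C\<close> and \<open>D\<close> are prime. If \<open>1 \<notin> S\<close>, the prime filter theorem (\<open>prime_filter_avoiding\<close>) gives a
  prime filter \<open>P\<close> disjoint from \<open>S\<close>; taking \<open>a\<close> or \<open>b\<close> to be \<open>bot\<close> shows
  \<open>P \<subseteq> \<Union>C\<close> and \<open>P \<subseteq> \<Union>D\<close>. This makes \<open>P\<close> compatible with the kernel of
  \<open>C\<close>, so some maximal filter above \<open>P\<close> belongs to \<open>C\<close>, and likewise one belongs to \<open>D\<close>
  (\<open>maximal_filter_in_closed\<close>). By the Gelfand property they coincide, contradicting disjointness.
\<close>

section \<open>Multiplication and order\<close>

lemma mult_right_mono_rl:
  fixes x y z :: "'a::residuated_lattice"
  assumes "x \<le> y"
  shows "x * z \<le> y * z"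
  using assms residuation order_trans order_refl by metis

lemma mult_mono_rl:
  fixes x y z w :: "'a::residuated_lattice"
  assumes "x \<le> y" "z \<le> w"
  shows "x * z \<le> y * w"
  using mult_right_mono_rl[OF assms(1), of z] mult_right_mono_rl[OF assms(2), of y]
  by (simp add: mult.commute order_trans)

lemma mult_le_left_rl: "x * y \<le> (x::'a::residuated_lattice)"
  using mult_mono_rl[of x x y 1] by (metis mult_1_right one_eq_top order_refl top_greatest)

lemma mult_le_right_rl: "x * y \<le> (y::'a::residuated_lattice)"
  using mult_le_left_rl[of y x] by (simp add: mult.commute)

text \<open>Residuation makes multiplication distribute over joins. Of the four products obtained by
  expanding the left-hand side, all but \<open>x * z\<close> have a factor \<open>y\<close>, hence lie below \<open>y\<close>.\<close>

lemma sup_mult_sup_le: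
  fixes x y z :: "'a::residuated_lattice"
  shows "sup x y * sup z y \<le> sup (x * z) y"
proof -
  have "x * sup z y \<le> sup (x * z) y"
  proof -
    have "z * x \<le> sup (x * z) y" "y * x \<le> sup (x * z) y"
      using mult_le_left_rl[of y x] by (auto simp: mult.commute intro: le_supI2)
    then have "sup z y * x \<le> sup (x * z) y"
      by (simp add: residuation)
    then show ?thesis by (simp add: mult.commute)
  qed
  moreover have "y * sup z y \<le> sup (x * z) y"
    using mult_le_left_rl by (rule le_supI2)
  ultimately show ?thesis
    by (simp add: residuation)
qed

section \<open>Filters\<close>

lemma rl_filter_mult: "rl_filter F \<Longrightarrow> x \<in> F \<Longrightarrow> y \<in> F \<Longrightarrow> x * y \<in> F"
  by (simp add: rl_filter_def)

lemma rl_filter_upward: "rl_filter F \<Longrightarrow> x \<in> F \<Longrightarrow> x \<le> y \<Longrightarrow> y \<in> F"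
  unfolding rl_filter_def by (metis sup.absorb2)

lemma rl_filter_one: "rl_filter F \<Longrightarrow> 1 \<in> F"
  using rl_filter_upward[of F _ 1] by (auto simp: one_eq_top rl_filter_def)

lemma rl_filterI:
  assumes "1 \<in> F"
    and "\<And>x y. x \<in> F \<Longrightarrow> y \<in> F \<Longrightarrow> x * y \<in> F"
    and "\<And>x y. x \<in> F \<Longrightarrow> x \<le> y \<Longrightarrow> y \<in> F"
  shows "rl_filter F"
  using assms unfolding rl_filter_def by (metis empty_iff sup_ge1)

lemma proper_filter_iff: "proper_filter F \<longleftrightarrow> rl_filter F \<and> bot \<notin> F"
  unfolding proper_filter_def using rl_filter_upward[of F bot] by auto

lemma rl_filter_Union_chain:
  assumes "subset.chain {F. rl_filter F} \<C>" "\<C> \<noteq> {}"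
  shows "rl_filter (\<Union>\<C>)"
proof (rule rl_filterI)
  have fil: "\<And>F. F \<in> \<C> \<Longrightarrow> rl_filter F"
    using assms(1) by (auto simp: subset.chain_def)
  show "1 \<in> \<Union>\<C>"
    using assms(2) fil rl_filter_one by blast
  show "x * y \<in> \<Union>\<C>" if xy: "x \<in> \<Union>\<C>" "y \<in> \<Union>\<C>" for x y
  proof -
    obtain F G where FG: "F \<in> \<C>" "x \<in> F" "G \<in> \<C>" "y \<in> G" using xy by auto
    have "F \<subseteq> G \<or> G \<subseteq> F"
      using assms(1) FG by (auto simp: subset.chain_def)
    then show ?thesis
      using FG fil rl_filter_mult by blast
  qed
  show "y \<in> \<Union>\<C>" if "x \<in> \<Union>\<C>" "x \<le> y" for x y
    using that fil rl_filter_upward by blast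
qed

section \<open>Prime and maximal filters\<close>

lemma maximal_avoiding_filter_exists:
  assumes "rl_filter F" "F \<inter> S = {}"
  obtains P where "rl_filter P" "F \<subseteq> P" "P \<inter> S = {}"
    "\<And>G. rl_filter G \<Longrightarrow> P \<subseteq> G \<Longrightarrow> G \<inter> S = {} \<Longrightarrow> G = P"
proof -
  let ?A = "{G. rl_filter G \<and> F \<subseteq> G \<and> G \<inter> S = {}}"
  have "\<exists>P\<in>?A. \<forall>G\<in>?A. P \<subseteq> G \<longrightarrow> G = P"
  proof (rule subset_Zorn_nonempty)
    show "?A \<noteq> {}" using assms by auto
    fix \<C> assume ne: "\<C> \<noteq> {}" and ch: "subset.chain ?A \<C>"
    have "subset.chain {F. rl_filter F} \<C>"
      using ch by (auto simp: subset.chain_def)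
    then have "rl_filter (\<Union>\<C>)" using ne by (rule rl_filter_Union_chain)
    moreover have "F \<subseteq> \<Union>\<C>" "\<Union>\<C> \<inter> S = {}"
      using ch ne by (fastforce simp: subset.chain_def)+
    ultimately show "\<Union>\<C> \<in> ?A" by simp
  qed
  then show thesis using that by (smt (verit) mem_Collect_eq order_trans)
qed

text \<open>This filter extends \<open>F\<close> and contains every \<open>x\<close> with \<open>sup x y \<in> F\<close>. It is used to test the
  maximality of \<open>F\<close> in place of the filter generated by \<open>F\<close> and \<open>x\<close>, whose description involves
  the powers of \<open>x\<close>. Closure under multiplication is \<open>sup_mult_sup_le\<close>.\<close>

lemma rl_filter_quotient:
  assumes "rl_filter F"
  shows "rl_filter {z. sup z y \<in> F}"
proof (rule rl_filterI)
  show "1 \<in> {z. sup z y \<in> F}"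
    using rl_filter_one[OF assms] by (simp add: one_eq_top)
  show "x * z \<in> {z. sup z y \<in> F}" if "x \<in> {z. sup z y \<in> F}" "z \<in> {z. sup z y \<in> F}" for x z
    using that rl_filter_mult[OF assms] rl_filter_upward[OF assms] sup_mult_sup_le by blast
  show "z \<in> {z. sup z y \<in> F}" if "x \<in> {z. sup z y \<in> F}" "x \<le> z" for x z
    using that rl_filter_upward[OF assms _ sup_mono[OF \<open>x \<le> z\<close> order_refl]] by blast
qed

text \<open>Suppose \<open>sup x y \<in> P\<close> with \<open>x, y \<notin> P\<close>. The filter of all \<open>z\<close> with \<open>sup z y \<in> P\<close>
  properly extends \<open>P\<close>, as it contains \<open>x\<close>; by maximality it contains some \<open>s \<in> S\<close>. Now
  \<open>sup y s \<in> P\<close>, so the same argument with \<open>s\<close> for \<open>y\<close> and \<open>y\<close> for \<open>x\<close> gives \<open>t \<in> S\<close> with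
  \<open>sup t s \<in> P\<close>. Thus \<open>sup t s\<close> lies in both \<open>P\<close> and \<open>S\<close>.\<close>

lemma maximal_avoiding_filter_prime:
  assumes P: "rl_filter P" "P \<inter> S = {}" "S \<noteq> {}"
    and S: "\<And>s t. s \<in> S \<Longrightarrow> t \<in> S \<Longrightarrow> sup s t \<in> S"
    and max: "\<And>G. rl_filter G \<Longrightarrow> P \<subseteq> G \<Longrightarrow> G \<inter> S = {} \<Longrightarrow> G = P"
  shows "prime_filter P"
  unfolding prime_filter_def
proof (intro conjI allI impI)
  show "proper_filter P"
    using P by (auto simp: proper_filter_def)
  have meets: "\<exists>s\<in>S. sup s v \<in> P" if "sup u v \<in> P" "u \<notin> P" for u v
  proof -
    have "P \<subseteq> {z. sup z v \<in> P}"
      using rl_filter_upward[OF P(1)] by auto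
    moreover have "{z. sup z v \<in> P} \<noteq> P" using that by auto
    ultimately show ?thesis
      using max[OF rl_filter_quotient[OF P(1), of v]] by blast
  qed
  fix x y assume xy: "sup x y \<in> P"
  show "x \<in> P \<or> y \<in> P"
  proof (rule ccontr)
    assume "\<not> (x \<in> P \<or> y \<in> P)"
    then obtain s where s: "s \<in> S" "sup s y \<in> P" and "y \<notin> P"
      using meets[OF xy] by auto
    then obtain t where "t \<in> S" "sup t s \<in> P"
      using meets[of y s] by (auto simp: sup_commute)
    then show False using S s P(2) by blast
  qed
qed

lemma prime_filter_avoiding:
  assumes "rl_filter F" "F \<inter> S = {}" "S \<noteq> {}"
    and "\<And>s t. s \<in> S \<Longrightarrow> t \<in> S \<Longrightarrow> sup s t \<in> S"
  obtains P where "prime_filter P" "F \<subseteq> P" "P \<inter> S = {}"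
  using maximal_avoiding_filter_exists[OF assms(1,2)]
    maximal_avoiding_filter_prime[OF _ _ assms(3,4)] by metis

text \<open>By \<open>proper_filter_iff\<close>, the maximal filters are the filters maximal among those avoiding
  \<open>{bot}\<close>, so the results on avoiding filters apply to them.\<close>

lemma maximal_filter_prime:
  assumes "maximal_filter M"
  shows "prime_filter M"
  by (rule maximal_avoiding_filter_prime[where S = "{bot}"])
    (use assms in \<open>auto simp: maximal_filter_def proper_filter_iff\<close>)

lemma maximal_filter_exists:
  assumes "proper_filter F"
  obtains M where "maximal_filter M" "F \<subseteq> M"
proof -
  have "rl_filter F" "F \<inter> {bot} = {}"
    using assms by (auto simp: proper_filter_iff)
  then obtain M where "rl_filter M" "F \<subseteq> M" "M \<inter> {bot} = {}"
    "\<And>G. rl_filter G \<Longrightarrow> M \<subseteq> G \<Longrightarrow> G \<inter> {bot} = {} \<Longrightarrow> G = M"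
    by (rule maximal_avoiding_filter_exists) blast
  then show thesis
    using that[of M] by (simp add: maximal_filter_def proper_filter_iff)
qed

section \<open>Closed and open sets of the spectrum\<close>

lemma rl_filter_generated_Un:
  assumes "rl_filter F" "rl_filter G"
  shows "rl_filter {z. \<exists>x\<in>F. \<exists>y\<in>G. x * y \<le> z}" (is "rl_filter ?J")
proof (rule rl_filterI)
  show "1 \<in> ?J"
    using assms[THEN rl_filter_one] by (auto intro!: bexI[of _ 1])
  show "u * v \<in> ?J" if uv: "u \<in> ?J" "v \<in> ?J" for u v
  proof -
    obtain x y x' y' where *: "x \<in> F" "y \<in> G" "x * y \<le> u" "x' \<in> F" "y' \<in> G" "x' * y' \<le> v"
      using uv by auto
    have "(x * x') * (y * y') \<le> u * v"
      using mult_mono_rl[OF *(3,6)] by (simp add: ac_simps)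
    then show ?thesis using * assms rl_filter_mult by blast
  qed
  show "v \<in> ?J" if "u \<in> ?J" "u \<le> v" for u v
    using that order_trans by blast
qed

text \<open>If an element of \<open>P\<close> and an element of the kernel \<open>\<Inter>C\<close> had product \<open>bot\<close>, then a member
  of \<open>C\<close> containing the former (there is one, as \<open>P \<subseteq> \<Union>C\<close>) would contain both, hence \<open>bot\<close>. So \<open>P\<close> and \<open>\<Inter>C\<close> generate a
  proper filter, and any maximal filter above it lies in \<open>C\<close>, as \<open>C\<close> is the hull of its kernel.\<close>

lemma maximal_filter_in_closed:
  fixes C :: "'a::residuated_lattice set set"
  assumes C: "closedin Spec_h C" and P: "rl_filter P" "P \<subseteq> \<Union>C"
  obtains M where "maximal_filter M" "P \<subseteq> M" "M \<in> C"
proof -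
  obtain X where X: "C = Spec \<inter> (\<Inter>x\<in>X. elem_hull x)"
    using C by (auto simp: closedin_Spec_h)
  have proper: "rl_filter Q" "bot \<notin> Q" if "Q \<in> C" for Q
    using that X by (auto simp: Spec_def prime_filter_def proper_filter_iff)
  define K where "K = \<Inter>C"
  have K: "rl_filter K"
    unfolding K_def
    by (rule rl_filterI) (use proper rl_filter_one rl_filter_mult rl_filter_upward in blast)+
  define J where "J = {z. \<exists>p\<in>P. \<exists>k\<in>K. p * k \<le> z}"
  have "bot \<notin> J"
  proof
    assume "bot \<in> J"
    then obtain p k where pk: "p \<in> P" "k \<in> K" "p * k \<le> bot" by (auto simp: J_def)
    then obtain Q where Q: "Q \<in> C" "p \<in> Q" using P by auto
    with pk have "p * k \<in> Q"
      using proper(1)[OF Q(1)] by (simp add: K_def rl_filter_mult)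
    then show False
      using pk(3) Q(1) proper rl_filter_upward by blast
  qed
  then have "proper_filter J"
    using rl_filter_generated_Un[OF P(1) K] by (simp add: proper_filter_iff J_def)
  then obtain M where M: "maximal_filter M" "J \<subseteq> M"
    by (rule maximal_filter_exists)
  have "P \<subseteq> J" "K \<subseteq> J"
    using rl_filter_one[OF P(1)] rl_filter_one[OF K] mult_le_left_rl mult_le_right_rl
    by (fastforce simp: J_def)+
  moreover have "X \<subseteq> K"
    by (auto simp: K_def X elem_hull_def)
  ultimately have "P \<subseteq> M" "X \<subseteq> M" using M by auto
  moreover from this have "M \<in> C"
    using maximal_filter_prime[OF M(1)] by (auto simp: X elem_hull_def Spec_def)
  ultimately show thesis using that M by blast
qed

lemma closedin_Spec_h_maximal_singleton:
  fixes M :: "'a::residuated_lattice set"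
  assumes "maximal_filter M"
  shows "closedin Spec_h {M}"
  unfolding closedin_Spec_h
proof
  show "{M} = Spec \<inter> (\<Inter>x\<in>M. elem_hull x)"
    using assms maximal_filter_prime[OF assms]
    by (auto simp: Spec_def elem_hull_def maximal_filter_def prime_filter_def)
qed

lemma openin_Spec_h_downward:
  assumes "openin Spec_h U" "Q \<in> U" "P \<in> Spec" "P \<subseteq> Q"
  shows "P \<in> U"
  using assms by (auto simp: openin_Spec_h elem_hull_def)

lemma openin_Spec_h_basic: "openin Spec_h (Spec - elem_hull x)"
  unfolding openin_Spec_h by (rule exI[of _ "{x}"]) simp

section \<open>Normality and the Gelfand property\<close>

lemma normal_imp_gelfand:
  assumes "normal_space (Spec_h :: 'a::residuated_lattice set topology)"
  shows "gelfand TYPE('a)"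
  unfolding gelfand_def
proof
  fix P :: "'a set" assume P: "P \<in> Spec"
  then have "proper_filter P"
    by (simp add: Spec_def prime_filter_def)
  then obtain M where M: "maximal_filter M" "P \<subseteq> M"
    by (rule maximal_filter_exists)
  have "N = M" if N: "maximal_filter N" "P \<subseteq> N" for N
  proof (rule ccontr)
    assume "N \<noteq> M"
    then have "disjnt {N} {M}" by simp
    then obtain U V where "openin Spec_h U" "openin Spec_h V" "N \<in> U" "M \<in> V" "disjnt U V"
      using assms closedin_Spec_h_maximal_singleton M(1) N(1)
      unfolding normal_space_def by (metis insert_subset)
    moreover from this have "P \<in> U" "P \<in> V"
      using P M N openin_Spec_h_downward by blast+
    ultimately show False by (auto simp: disjnt_iff)
  qed
  with M show "\<exists>!M. maximal_filter M \<and> P \<subseteq> M" by blast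
qed

lemma gelfand_imp_normal:
  assumes gelfand: "gelfand TYPE('a::residuated_lattice)"
  shows "normal_space (Spec_h :: 'a set topology)"
  unfolding normal_space_def
proof (intro allI impI, elim conjE)
  fix C D :: "'a set set"
  assume C: "closedin Spec_h C" and D: "closedin Spec_h D" and disj: "disjnt C D"
  have CD_Spec: "C \<subseteq> Spec" "D \<subseteq> Spec"
    using C D closedin_subset topspace_Spec_h by blast+
  then have prime: "sup x y \<in> Q \<Longrightarrow> x \<in> Q \<or> y \<in> Q" and bot: "bot \<notin> Q"
    if "Q \<in> C \<union> D" for Q x y
    using that by (auto simp: Spec_def prime_filter_def proper_filter_iff)
  define S where "S = {sup a b | a b. a \<notin> \<Union>C \<and> b \<notin> \<Union>D}"
  have S_sup: "sup s t \<in> S" if st: "s \<in> S" "t \<in> S" for s t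
  proof -
    obtain a b a' b' where *: "s = sup a b" "t = sup a' b'"
      "a \<notin> \<Union>C" "b \<notin> \<Union>D" "a' \<notin> \<Union>C" "b' \<notin> \<Union>D"
      using st by (auto simp: S_def)
    have "sup a a' \<notin> \<Union>C" "sup b b' \<notin> \<Union>D"
      using *(3-6) by (auto dest: prime[rotated])
    moreover have "sup s t = sup (sup a a') (sup b b')"
      by (simp add: * ac_simps)
    ultimately show ?thesis unfolding S_def by blast
  qed
  have S_I: "sup a b \<in> S" if "a \<notin> \<Union>C" "b \<notin> \<Union>D" for a b
    using that unfolding S_def by blast
  have bot_notin: "bot \<notin> \<Union>C" "bot \<notin> \<Union>D"
    using bot by auto
  have S_left: "a \<in> S" if "a \<notin> \<Union>C" for a
    using S_I[OF that bot_notin(2)] by (simp only: sup_bot_right)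
  have S_right: "b \<in> S" if "b \<notin> \<Union>D" for b
    using S_I[OF bot_notin(1) that] by (simp only: sup_bot_left)
  have "1 \<in> S"
  proof (rule ccontr)
    assume "1 \<notin> S"
    then have disj_S: "{1} \<inter> S = {}" by simp
    have one_filter: "rl_filter {1::'a}"
      by (rule rl_filterI) (use top_unique[where 'a = 'a, folded one_eq_top] in auto)
    have "S \<noteq> {}"
      using S_left[OF bot_notin(1)] by auto
    from prime_filter_avoiding[OF one_filter disj_S this S_sup]
    obtain P where P: "prime_filter P" "P \<inter> S = {}" by metis
    have fil: "rl_filter P"
      using P(1) by (simp add: prime_filter_def proper_filter_def)
    have "P \<subseteq> \<Union>C" "P \<subseteq> \<Union>D"
      using S_left S_right P(2) by blast+
    then obtain M N where "maximal_filter M" "P \<subseteq> M" "M \<in> C"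
      and "maximal_filter N" "P \<subseteq> N" "N \<in> D"
      using maximal_filter_in_closed[OF C fil] maximal_filter_in_closed[OF D fil] by metis
    moreover from this have "M = N"
      using gelfand P(1) unfolding gelfand_def Spec_def by blast
    ultimately show False using disj by (auto simp: disjnt_iff)
  qed
  then obtain a b where ab: "a \<notin> \<Union>C" "b \<notin> \<Union>D" "sup a b = 1"
    unfolding S_def by auto
  have "a \<in> Q \<or> b \<in> Q" if "Q \<in> Spec" for Q
    using that rl_filter_one[of Q] ab(3)
    by (auto simp: Spec_def prime_filter_def proper_filter_def)
  then have "disjnt (Spec - elem_hull a) (Spec - elem_hull b)"
    by (auto simp: disjnt_iff elem_hull_def)
  moreover have "C \<subseteq> Spec - elem_hull a" "D \<subseteq> Spec - elem_hull b"
    using CD_Spec ab by (auto simp: elem_hull_def)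
  ultimately show "\<exists>U V. openin Spec_h U \<and> openin Spec_h V \<and> C \<subseteq> U \<and> D \<subseteq> V \<and> disjnt U V"
    using openin_Spec_h_basic by blast
qed

theorem theorem3p10:
  shows "gelfand TYPE('a::residuated_lattice) \<longleftrightarrow> normal_space (Spec_h :: 'a set topology)"
  using gelfand_imp_normal normal_imp_gelfand by blast

end
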